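(* The limits of the operators $\mathbf B(x),\mathbf C(x)$ (which depend on $M$) satisfy $$\lim_{M\rightarrow \infty}\mathbf{B}(x)=\exp\left(\sum^{\infty}_{n=1}\frac{x^n}{n}H_{-n}\right),\qquad \lim_{M\rightarrow \infty}\mathbf{C}(x)=\exp\left(\sum^{\infty}_{n=1}\frac{x^n}{n}H_n\right),$$ $$\lim_{M\rightarrow \infty}\mathbf{C}(x)\mathbf{B}(y)=\frac{1}{1-xy}\lim_{M\rightarrow \infty}\mathbf{B}(y)\mathbf{C}(x).$$
   Context: $b(i),c(i)$ ($i\in\mathbb Z$) satisfy $\{b(i),c(j)\}=\delta_{i,-j}$, $\{b(i),b(j)\}=\{c(i),c(j)\}=0$, where $\{A,B\}=AB+BA$. They act on the Fock space $\mathcal F$ generated by $|0\rangle$ with $b(m+1)|0\rangle=c(m)|0\rangle=0$ for $m\ge 0$. For a positive integer $M$, $$\mathbf B(x)=\exp(x\,b(-M+1)c(M-2))\exp(x\,b(-M+2)c(M-3))\cdots,$$ the ordered product of $\exp(x\,b(-(i-1))c(i-2))$, $i\le M$, with $i$ decreasing from left to right, and $$\mathbf C(x)=\cdots\exp(x\,b(-M+3)c(M-2))\exp(x\,b(-M+2)c(M-1)),$$ the ordered product of $\exp(x\,b(-i+2)c(i-1))$, $i\le M$, with $i$ decreasing from right to left. On each fixed vector all but finitely many factors act as the identity. For $n\ge1$, $$H_{-n}=\lim_{M\to\infty}\sum_{i=-\infty}^{M-1}b(-i)c(i-n)=\sum_{i\in\mathbb Z}b(-i)c(i-n),\qquad H_n=\lim_{M\to\infty}\sum_{i=-\infty}^{M-1}b(-i+n)c(i)=\sum_{i\in\mathbb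 Z}b(-i+n)c(i).$$ Operators are viewed as formal power series in $x,y$; limits $M\to\infty$ are taken coefficientwise in $x,y$ and pointwise on vectors of $\mathcal F$ (the values stabilize), and $\frac1{1-xy}=\sum_k (xy)^k$. *)

theory Defs
  imports Complex_Main "HOL-Library.Groups_Big_Fun"
begin

section \<open>Charged free fermions and their Fock space\<close>

text \<open>The last axiom says that the vacuum generates the whole space under the fermions.
  The relations and the vacuum conditions determine such a nonzero module up to isomorphism,
  so this characterises the Fock space.\<close>

locale fock_space = vector_space scale
  for scale :: "'k::field_char_0 \<Rightarrow> 'v::ab_group_add \<Rightarrow> 'v" +
  fixes b c :: "int \<Rightarrow> 'v \<Rightarrow> 'v" and vac :: 'v
  assumes linear_b: "Vector_Spaces.linear scale scale (b i)"
    and linear_c: "Vector_Spaces.linear scale scale (c i)"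
    and anticomm_bc: "b i (c j v) + c j (b i v) = (if i = - j then v else 0)"
    and anticomm_bb: "b i (b j v) + b j (b i v) = 0"
    and anticomm_cc: "c i (c j v) + c j (c i v) = 0"
    and b_vac: "m \<ge> 0 \<Longrightarrow> b (m + 1) vac = 0"
    and c_vac: "m \<ge> 0 \<Longrightarrow> c m vac = 0"
    and vac_nonzero: "vac \<noteq> 0"
    and vac_generates:
      "\<lbrakk>subspace S; vac \<in> S; \<And>i v. v \<in> S \<Longrightarrow> b i v \<in> S; \<And>i v. v \<in> S \<Longrightarrow> c i v \<in> S\<rbrakk>
        \<Longrightarrow> S = UNIV"

section \<open>Formal power series of operators\<close>

text \<open>A formal power series in one variable with operator coefficients is the function sending
  \<open>k\<close> to the coefficient of \<open>x^k\<close>.  A series in \<open>x\<close> and \<open>y\<close> is indexed by pairs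
  \<open>(i, j)\<close>, standing for the monomial \<open>x^i y^j\<close>.\<close>

type_synonym 'v op_series = "nat \<Rightarrow> 'v \<Rightarrow> 'v"
type_synonym 'v op_series2 = "nat \<times> nat \<Rightarrow> 'v \<Rightarrow> 'v"

definition ser_one :: "('v::ab_group_add) op_series" where
  "ser_one = (\<lambda>k v. if k = 0 then v else 0)"

definition ser_mult :: "('v::ab_group_add) op_series \<Rightarrow> 'v op_series \<Rightarrow> 'v op_series" where
  "ser_mult S T = (\<lambda>k v. \<Sum>i\<le>k. S i (T (k - i) v))"

primrec ser_power :: "('v::ab_group_add) op_series \<Rightarrow> nat \<Rightarrow> 'v op_series" where
  "ser_power S 0 = ser_one"
| "ser_power S (Suc m) = ser_mult S (ser_power S m)"

text \<open>The exponential is only meant for series without constant term; then the \<open>m\<close>-th power has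
  no coefficients below degree \<open>m\<close>, so the exponential series may be cut off at \<open>m = k\<close> in
  degree \<open>k\<close>.\<close>

definition ser_exp ::
  "('k::field_char_0 \<Rightarrow> 'v::ab_group_add \<Rightarrow> 'v) \<Rightarrow> 'v op_series \<Rightarrow> 'v op_series" where
  "ser_exp scale S = (\<lambda>k v. \<Sum>m\<le>k. scale (1 / fact m) (ser_power S m k v))"

definition ser_linear :: "('v::ab_group_add \<Rightarrow> 'v) \<Rightarrow> 'v op_series" where
  "ser_linear A = (\<lambda>k v. if k = 1 then A v else 0)" \<comment> \<open>the series \<open>x A\<close>\<close>

text \<open>Limits are taken coefficientwise and pointwise on vectors, for the discrete topology: the
  values become constant.  The index type is \<open>nat\<close> or \<open>nat \<times> nat\<close>, for series in one or two
  variables.\<close>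

definition ser_tendsto :: "(nat \<Rightarrow> 'i \<Rightarrow> 'v \<Rightarrow> 'v) \<Rightarrow> ('i \<Rightarrow> 'v \<Rightarrow> 'v) \<Rightarrow> bool" where
  "ser_tendsto S L \<longleftrightarrow> (\<forall>k v. eventually (\<lambda>N. S N k v = L k v) sequentially)"

definition ser_lim :: "(nat \<Rightarrow> 'i \<Rightarrow> 'v \<Rightarrow> 'v) \<Rightarrow> 'i \<Rightarrow> 'v \<Rightarrow> 'v" where
  "ser_lim S = (THE L. ser_tendsto S L)"

text \<open>Partial products \<open>E\<^sub>0 E\<^sub>1 \<dots> E\<^bsub>K-1\<^esub>\<close> and
  \<open>E\<^bsub>K-1\<^esub> \<dots> E\<^sub>1 E\<^sub>0\<close>.\<close>

primrec prod_right :: "(nat \<Rightarrow> ('v::ab_group_add) op_series) \<Rightarrow> nat \<Rightarrow> 'v op_series" where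
  "prod_right E 0 = ser_one"
| "prod_right E (Suc K) = ser_mult (prod_right E K) (E K)"

primrec prod_left :: "(nat \<Rightarrow> ('v::ab_group_add) op_series) \<Rightarrow> nat \<Rightarrow> 'v op_series" where
  "prod_left E 0 = ser_one"
| "prod_left E (Suc K) = ser_mult (E K) (prod_left E K)"

section \<open>The operators\<close>

text \<open>In both infinite products the factors are enumerated as \<open>i = M - k\<close> with
  \<open>k = 0, 1, 2, \<dots>\<close>; in \<open>opB\<close> the product extends to the right, in \<open>opC\<close> to the left.\<close>

definition opB :: "('k::field_char_0 \<Rightarrow> 'v::ab_group_add \<Rightarrow> 'v) \<Rightarrow> (int \<Rightarrow> 'v \<Rightarrow> 'v) \<Rightarrow>
    (int \<Rightarrow> 'v \<Rightarrow> 'v) \<Rightarrow> nat \<Rightarrow> 'v op_series" where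
  "opB scale b c M = ser_lim (prod_right (\<lambda>k.
     let i = int M - int k in ser_exp scale (ser_linear (b (- (i - 1)) \<circ> c (i - 2)))))"

definition opC :: "('k::field_char_0 \<Rightarrow> 'v::ab_group_add \<Rightarrow> 'v) \<Rightarrow> (int \<Rightarrow> 'v \<Rightarrow> 'v) \<Rightarrow>
    (int \<Rightarrow> 'v \<Rightarrow> 'v) \<Rightarrow> nat \<Rightarrow> 'v op_series" where
  "opC scale b c M = ser_lim (prod_left (\<lambda>k.
     let i = int M - int k in ser_exp scale (ser_linear (b (- i + 2) \<circ> c (i - 1)))))"

text \<open>\<open>H_neg b c n\<close> is \<open>H\<^bsub>-n\<^esub>\<close> and \<open>H_pos b c n\<close> is \<open>H\<^sub>n\<close>, for \<open>n \<ge> 1\<close>; on each vector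
  only finitely many terms of the sum over all integers are nonzero.\<close>

definition H_neg :: "(int \<Rightarrow> 'v \<Rightarrow> 'v) \<Rightarrow> (int \<Rightarrow> 'v \<Rightarrow> 'v) \<Rightarrow> nat \<Rightarrow> 'v::ab_group_add \<Rightarrow> 'v" where
  "H_neg b c n v = Sum_any (\<lambda>i::int. b (- i) (c (i - int n) v))"

definition H_pos :: "(int \<Rightarrow> 'v \<Rightarrow> 'v) \<Rightarrow> (int \<Rightarrow> 'v \<Rightarrow> 'v) \<Rightarrow> nat \<Rightarrow> 'v::ab_group_add \<Rightarrow> 'v" where
  "H_pos b c n v = Sum_any (\<lambda>i::int. b (- i + int n) (c i v))"

text \<open>The series \<open>\<Sum>n\<ge>1. (x^n / n) A\<^sub>n\<close>.\<close>

definition log_ser ::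
  "('k::field_char_0 \<Rightarrow> 'v::ab_group_add \<Rightarrow> 'v) \<Rightarrow> (nat \<Rightarrow> 'v \<Rightarrow> 'v) \<Rightarrow> 'v op_series" where
  "log_ser scale A = (\<lambda>n v. if n = 0 then 0 else scale (1 / of_nat n) (A n v))"

text \<open>The scalar series \<open>1 / (1 - x y) = \<Sum>k. (x y)^k\<close>, and the product of a scalar series with
  an operator series.\<close>

definition geom_xy :: "nat \<times> nat \<Rightarrow> 'k::field_char_0" where
  "geom_xy = (\<lambda>(i, j). if i = j then 1 else 0)"

definition ser2_scale :: "('k::field_char_0 \<Rightarrow> 'v::ab_group_add \<Rightarrow> 'v) \<Rightarrow>
    (nat \<times> nat \<Rightarrow> 'k) \<Rightarrow> 'v op_series2 \<Rightarrow> 'v op_series2" where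
  "ser2_scale scale s T =
     (\<lambda>(m, n) v. \<Sum>i\<le>m. \<Sum>j\<le>n. scale (s (i, j)) (T (m - i, n - j) v))"

end

theory Submission
  imports Defs
begin

text \<open>Write \<open>A\<^sub>n\<close> for \<open>H\<^bsub>-n\<^esub>\<close> or for \<open>H\<^sub>n\<close>.  The exponential of \<open>\<Sum>n\<ge>1. (x^n / n) A\<^sub>n\<close> and
  the limit of the ordered products both turn out to be the unique solution of
  \<open>x F'(x) = (\<Sum>n\<ge>1. x^n A\<^sub>n) F(x)\<close> with \<open>F(0) = 1\<close>.  In degree \<open>k\<close> this equation is Newton's recurrence
  \<open>k F\<^sub>k = \<Sum>n=1..k. A\<^sub>n F\<^bsub>k-n\<^esub>\<close>, the one that links complete symmetric functions to power sums; its
  solution is called \<open>newton\<close> below.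

  For the exponential the equation holds because the \<open>A\<^sub>n\<close> commute (\<open>ser_exp_log_ser\<close>).
  For a product, think of \<open>b(-i) c(j)\<close> as moving a fermion from site \<open>j\<close> to site \<open>i\<close>.  Its square
  vanishes for \<open>i \<noteq> j\<close>, so a factor is \<open>1 + x b(-i) c(i-1)\<close>; it crosses the bond between the neighbouring
  sites \<open>i - 1\<close> and \<open>i\<close>.  A finite ordered product over a chain of bonds solves the equation in which
  \<open>A\<^sub>n\<close> contains only the jumps \<open>b(-i) c(i-n)\<close> along that chain; this is an induction that adds
  bonds at the top of the chain (\<open>newton_chain_extend\<close>).  Because \<open>F\<^sub>k v\<close> needs only finitely many
  values of the \<open>A\<^sub>n\<close>, and each \<open>A\<^sub>n\<close> is a finite sum on a given vector, one may let the chain grow, first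
  downwards to obtain \<open>\<^bold>B\<close> for a given \<open>M\<close> and then upwards as \<open>M \<rightarrow> \<infinity>\<close> (\<open>newton_eventually_eq\<close>).
  The substitution of \<open>b(-i), c(-i)\<close> for \<open>b(i), c(i)\<close> preserves the anticommutation relations
  and carries \<open>H\<^bsub>-n\<^esub>\<close> to \<open>H\<^sub>n\<close> and the factors of \<open>\<^bold>B\<close> to those of \<open>\<^bold>C\<close>, in the right order.

  The exchange relation rests on the Heisenberg relation \<open>[H\<^sub>m, H\<^bsub>-n\<^esub>] = m \<delta>\<^bsub>m,n\<^esub>\<close>
  (\<open>current_commutator\<close>), which also gives the commutation used above.  It implies
  \<open>[H\<^sub>m, B\<^sub>j] = B\<^bsub>j-m\<^esub>\<close> for the coefficients of the limit of \<open>\<^bold>B(y)\<close>, and feeding this into the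
  recurrence of the coefficients \<open>C\<^sub>i\<close> of the limit of \<open>\<^bold>C(x)\<close> yields
  \<open>C\<^sub>i B\<^sub>j = \<Sum>k. B\<^bsub>j-k\<^esub> C\<^bsub>i-k\<^esub>\<close>, which is the factor \<open>1 / (1 - x y)\<close>.\<close>

section \<open>Power series with operator coefficients\<close>

lemma sum_triangle_swap:
  fixes f :: "nat \<Rightarrow> nat \<Rightarrow> 'a::comm_monoid_add"
  shows "(\<Sum>i\<le>k. \<Sum>j\<le>k - i. f i j) = (\<Sum>j\<le>k. \<Sum>i\<le>k - j. f i j)"
proof -
  have "(\<Sum>i\<le>k. \<Sum>j\<le>k - i. f i j) = (\<Sum>(i, j)\<in>(SIGMA i:{..k}. {..k - i}). f i j)"
    by (simp add: sum.Sigma)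
  also have "\<dots> = (\<Sum>(j, i)\<in>(SIGMA j:{..k}. {..k - j}). f i j)"
    by (rule sum.reindex_bij_witness[of _ prod.swap prod.swap]) auto
  also have "\<dots> = (\<Sum>j\<le>k. \<Sum>i\<le>k - j. f i j)"
    by (simp add: sum.Sigma)
  finally show ?thesis .
qed

lemma sum_triangle_diagonals:
  fixes f :: "nat \<Rightarrow> nat \<Rightarrow> 'a::comm_monoid_add"
  shows "(\<Sum>i\<le>k. \<Sum>j\<le>k - i. f i j) = (\<Sum>l\<le>k. \<Sum>i\<le>l. f i (l - i))"
proof -
  have "(\<Sum>i\<le>k. \<Sum>j\<le>k - i. f i j) = (\<Sum>(i, j)\<in>(SIGMA i:{..k}. {..k - i}). f i j)"
    by (simp add: sum.Sigma)
  also have "(SIGMA i:{..k}. {..k - i}) = {(i, j). i + j \<le> k}"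
    by auto
  finally show ?thesis
    by (simp add: sum.triangle_reindex_eq)
qed

lemma ser_mult_one_left: "ser_mult ser_one T = T"
proof (intro ext)
  fix k v
  have "(\<Sum>i\<le>k. if i = 0 then T (k - i) v else 0) = T k v"
    by (simp add: sum.delta')
  then show "ser_mult ser_one T k v = T k v"
    by (simp add: ser_mult_def ser_one_def)
qed

lemma ser_mult_one_right:
  assumes "\<And>i. S i 0 = 0"
  shows "ser_mult S ser_one = S"
proof (intro ext)
  fix k v
  have "(\<Sum>i\<le>k. S i (if k - i = 0 then v else 0)) = (\<Sum>i\<le>k. if i = k then S i v else 0)"
    using assms by (intro sum.cong) auto
  then show "ser_mult S ser_one k v = S k v"
    by (simp add: ser_mult_def ser_one_def)
qed

lemma ser_mult_assoc:
  assumes "\<And>i. Modules.additive (S i)"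
  shows "ser_mult S (ser_mult T U) = ser_mult (ser_mult S T) U"
proof (intro ext)
  fix k v
  have "ser_mult S (ser_mult T U) k v = (\<Sum>i\<le>k. \<Sum>j\<le>k - i. S i (T j (U (k - i - j) v)))"
    by (simp add: ser_mult_def additive.sum[OF assms])
  also have "\<dots> = (\<Sum>l\<le>k. \<Sum>i\<le>l. S i (T (l - i) (U (k - l) v)))"
    by (subst sum_triangle_diagonals) (auto intro!: sum.cong)
  also have "\<dots> = ser_mult (ser_mult S T) U k v"
    by (simp add: ser_mult_def)
  finally show "ser_mult S (ser_mult T U) k v = ser_mult (ser_mult S T) U k v" .
qed

lemma prod_left_cong:
  assumes "\<And>k. k < K \<Longrightarrow> E k = F k"
  shows "prod_left E K = prod_left F K"
  using assms by (induction K) auto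

text \<open>\<open>\<^bold>B\<close> grows to the right, at the low end of the chain, while the induction that evaluates it
  adds factors on the left.  Associativity lets a finite product be read in either direction.\<close>

lemma prod_right_eq_prod_left:
  assumes "\<And>n i. Modules.additive (E n i)"
  shows "prod_right E K = prod_left (\<lambda>k. E (K - 1 - k)) K"
proof -
  have first: "prod_right E (Suc K) = ser_mult (E 0) (prod_right (\<lambda>k. E (Suc k)) K)"
    if "\<And>n i. Modules.additive (E n i)" for K and E :: "nat \<Rightarrow> 'a op_series"
  proof (induction K)
    case 0
    show ?case
      by (simp add: ser_mult_one_left ser_mult_one_right additive.zero[OF that])
  next
    case (Suc K)
    then show ?case
      by (simp add: ser_mult_assoc[OF that])
  qed
  show ?thesis
    using assms
  proof (induction K arbitrary: E)
    case 0
    show ?case by simp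
  next
    case (Suc K)
    have "prod_right E (Suc K) = ser_mult (E 0) (prod_right (\<lambda>k. E (Suc k)) K)"
      by (rule first) (rule Suc.prems)
    also have "prod_right (\<lambda>k. E (Suc k)) K = prod_left (\<lambda>k. E (Suc (K - 1 - k))) K"
      by (rule Suc.IH) (rule Suc.prems)
    also have "\<dots> = prod_left (\<lambda>k. E (Suc K - 1 - k)) K"
      by (rule prod_left_cong) (metis Suc_diff_Suc diff_Suc_1 diff_Suc_eq_diff_pred)
    finally show ?case
      by simp
  qed
qed

lemma ser_lim_eq:
  assumes "ser_tendsto S L"
  shows "ser_lim S = L"
  unfolding ser_lim_def
proof (rule the_equality)
  fix L'
  assume L': "ser_tendsto S L'"
  show "L' = L"
  proof (intro ext)
    fix k v
    have "\<forall>\<^sub>F N in sequentially. S N k v = L' k v \<and> S N k v = L k v"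
      using L' assms by (auto simp: ser_tendsto_def intro: eventually_conj)
    then obtain N where "S N k v = L' k v \<and> S N k v = L k v"
      by (auto simp: eventually_sequentially)
    then show "L' k v = L k v"
      by metis
  qed
qed (rule assms)

text \<open>For a fixed vector the inner value is eventually constant; after that only the outer factor
  still varies, applied to a fixed vector.\<close>

lemma ser_tendsto_comp:
  fixes f :: "'i \<Rightarrow> 'j \<Rightarrow> 'm" and g :: "'i \<Rightarrow> 'j \<Rightarrow> 'n"
  assumes "ser_tendsto S L" "ser_tendsto T L'"
  shows "ser_tendsto (\<lambda>M (i, j). S M (f i j) \<circ> T M (g i j)) (\<lambda>(i, j). L (f i j) \<circ> L' (g i j))"
  unfolding ser_tendsto_def
proof (intro allI)
  fix ij :: "'i \<times> 'j" and v
  obtain i j where ij: "ij = (i, j)"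
    by fastforce
  have "\<forall>\<^sub>F M in sequentially. T M (g i j) v = L' (g i j) v \<and> S M (f i j) (L' (g i j) v) = L (f i j) (L' (g i j) v)"
    using assms by (auto simp: ser_tendsto_def intro: eventually_conj)
  then show "\<forall>\<^sub>F M in sequentially. (case ij of (i, j) \<Rightarrow> S M (f i j) \<circ> T M (g i j)) v
      = (case ij of (i, j) \<Rightarrow> L (f i j) \<circ> L' (g i j)) v"
    by (rule eventually_mono) (simp add: ij)
qed

section \<open>Newton's recurrence\<close>

text \<open>The coefficient of \<open>x^k\<close> in the solution \<open>F\<close> of \<open>x F' = (\<Sum>n\<ge>1. x^n A\<^sub>n) F\<close>, \<open>F(0) = 1\<close>.\<close>

fun newton :: "('k::field_char_0 \<Rightarrow> 'v::ab_group_add \<Rightarrow> 'v) \<Rightarrow> (nat \<Rightarrow> 'v \<Rightarrow> 'v) \<Rightarrow> 'v op_series" where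
  "newton scale A 0 v = v"
| "newton scale A (Suc k) v =
     scale (1 / of_nat (Suc k)) (\<Sum>n\<le>k. A (Suc n) (newton scale A (k - n) v))"

locale char0_vector_space = vector_space scale
  for scale :: "'k::field_char_0 \<Rightarrow> 'v::ab_group_add \<Rightarrow> 'v"
begin

abbreviation endo :: "('v \<Rightarrow> 'v) \<Rightarrow> bool" where
  "endo \<equiv> Vector_Spaces.linear scale scale"

lemma endo_iff:
  "endo f \<longleftrightarrow> (\<forall>u v. f (u + v) = f u + f v) \<and> (\<forall>r v. f (scale r v) = scale r (f v))"
  using vector_space_axioms by (simp add: Vector_Spaces.linear_iff)

lemma endoI:
  "\<lbrakk>\<And>u v. f (u + v) = f u + f v; \<And>r v. f (scale r v) = scale r (f v)\<rbrakk> \<Longrightarrow> endo f"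
  by (simp add: endo_iff)

lemma endo_module_hom: "endo f \<Longrightarrow> module_hom scale scale f"
  by (simp add: module_hom_iff_linear)

lemmas endo_add = module_hom.add[OF endo_module_hom]
  and endo_scale = module_hom.scale[OF endo_module_hom]
  and endo_zero = module_hom.zero[OF endo_module_hom]
  and endo_neg = module_hom.neg[OF endo_module_hom]
  and endo_diff = module_hom.diff[OF endo_module_hom]
  and endo_sum = module_hom.sum[OF endo_module_hom]

lemma endo_compose: "endo f \<Longrightarrow> endo g \<Longrightarrow> endo (\<lambda>v. f (g v))"
  by (simp add: endo_iff)

lemma endo_sumI: "(\<And>i. i \<in> I \<Longrightarrow> endo (f i)) \<Longrightarrow> endo (\<lambda>v. \<Sum>i\<in>I. f i v)"
  by (rule endoI) (simp_all add: endo_add endo_scale sum.distrib scale_sum_right)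

lemma endo_scaleI: "endo f \<Longrightarrow> endo (\<lambda>v. scale r (f v))"
  by (rule endoI) (simp_all add: endo_add endo_scale scale_right_distrib mult.commute)

lemma scale_of_nat_cancel:
  assumes "scale (of_nat (Suc k)) u = scale (of_nat (Suc k)) v"
  shows "u = v"
  using assms scale_left_imp_eq[of "of_nat (Suc k)" u v] of_nat_neq_0 by blast

lemma newton_rec:
  "scale (of_nat (Suc k)) (newton scale A (Suc k) v) = (\<Sum>n\<le>k. A (Suc n) (newton scale A (k - n) v))"
  using of_nat_neq_0[of k, where 'a='k] by (simp del: of_nat_Suc)

lemma newton_unique:
  assumes "\<And>v. Q 0 v = v"
    and "\<And>k v. scale (of_nat (Suc k)) (Q (Suc k) v) = (\<Sum>n\<le>k. A (Suc n) (Q (k - n) v))"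
  shows "Q = newton scale A"
proof (intro ext)
  fix k v
  show "Q k v = newton scale A k v"
  proof (induction k rule: less_induct)
    case (less k)
    show ?case
    proof (cases k)
      case 0
      then show ?thesis using assms(1) by simp
    next
      case (Suc k')
      have "scale (of_nat (Suc k')) (Q (Suc k') v) = scale (of_nat (Suc k')) (newton scale A (Suc k') v)"
        unfolding assms(2) newton_rec
        by (rule sum.cong[OF refl]) (use less Suc in simp)
      then show ?thesis
        using Suc scale_of_nat_cancel by blast
    qed
  qed
qed

lemma newton_cong:
  assumes "\<And>n. A (Suc n) = A' (Suc n)"
  shows "newton scale A = newton scale A'"
  by (rule newton_unique) (simp, simp only: newton_rec assms)

lemma newton_linear:
  assumes "\<And>n. endo (A (Suc n))"
  shows "endo (newton scale A k)"
proof (induction k rule: less_induct)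
  case (less k)
  show ?case
  proof (cases k)
    case 0
    then show ?thesis by (simp add: endo_iff)
  next
    case (Suc k')
    have "endo (\<lambda>v. scale (1 / of_nat (Suc k')) (\<Sum>n\<le>k'. A (Suc n) (newton scale A (k' - n) v)))"
      by (intro endo_scaleI endo_sumI endo_compose[OF assms]) (use less Suc in simp)
    then show ?thesis
      using Suc by (simp add: fun_eq_iff newton.simps[abs_def])
  qed
qed

text \<open>\<open>newton scale L k v\<close> is computed by applying finitely many \<open>L\<^sub>n\<close> to finitely many vectors, so
  it is continuous in \<open>L\<close> for pointwise stabilization.\<close>

lemma newton_eventually_eq:
  assumes "\<And>n v. \<forall>\<^sub>F N in F. A N (Suc n) v = L (Suc n) v"
  shows "\<forall>\<^sub>F N in F. newton scale (A N) k v = newton scale L k v"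
proof (induction k rule: less_induct)
  case (less k)
  show ?case
  proof (cases k)
    case 0
    then show ?thesis by simp
  next
    case (Suc k')
    have "\<forall>\<^sub>F N in F. \<forall>n\<in>{..k'}. newton scale (A N) (k' - n) v = newton scale L (k' - n) v
        \<and> A N (Suc n) (newton scale L (k' - n) v) = L (Suc n) (newton scale L (k' - n) v)"
      by (intro eventually_ball_finite finite_atMost ballI eventually_conj assms less)
        (use Suc in auto)
    then show ?thesis
      by (rule eventually_mono) (simp add: Suc)
  qed
qed

text \<open>The chain rule \<open>x (S^(m+1))' = (m + 1) (x S') S^m\<close>, valid because the coefficients of \<open>S\<close> commute.\<close>

lemma ser_power_newton:
  assumes lin: "\<And>n. endo (S n)" and comm: "\<And>m n v. S m (S n v) = S n (S m v)"
  shows "scale (of_nat k) (ser_power S (Suc m) k v) =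
    scale (of_nat (Suc m)) (\<Sum>n\<le>k. scale (of_nat n) (S n (ser_power S m (k - n) v)))"
proof (induction m arbitrary: k)
  case 0
  have *: "ser_mult S ser_one = S"
    by (rule ser_mult_one_right) (rule endo_zero[OF lin])
  have "(\<Sum>n\<le>k. scale (of_nat n) (S n (ser_one (k - n) v)))
      = (\<Sum>n\<le>k. if n = k then scale (of_nat n) (S n v) else 0)"
    by (intro sum.cong) (auto simp: ser_one_def endo_zero[OF lin])
  then show ?case
    by (simp add: *)
next
  case (Suc m)
  let ?P = "ser_power S"
  have "scale (of_nat k) (?P (Suc (Suc m)) k v)
      = (\<Sum>n\<le>k. scale (of_nat k) (S n (?P (Suc m) (k - n) v)))"
    by (simp add: ser_mult_def scale_sum_right)
  also have "\<dots> = (\<Sum>n\<le>k. scale (of_nat n) (S n (?P (Suc m) (k - n) v))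
       + S n (scale (of_nat (k - n)) (?P (Suc m) (k - n) v)))"
    by (intro sum.cong refl)
      (simp add: endo_scale[OF lin] flip: scale_left_distrib of_nat_add del: ser_power.simps)
  also have "\<dots> = (\<Sum>n\<le>k. scale (of_nat n) (S n (?P (Suc m) (k - n) v)))
      + (\<Sum>n\<le>k. S n (scale (of_nat (Suc m))
          (\<Sum>l\<le>k - n. scale (of_nat l) (S l (?P m (k - n - l) v)))))"
    by (simp only: Suc.IH sum.distrib)
  also have "(\<Sum>n\<le>k. S n (scale (of_nat (Suc m))
          (\<Sum>l\<le>k - n. scale (of_nat l) (S l (?P m (k - n - l) v)))))
      = (\<Sum>n\<le>k. \<Sum>l\<le>k - n. scale (of_nat (Suc m)) (scale (of_nat l) (S l (S n (?P m (k - l - n) v)))))"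
    by (intro sum.cong refl)
      (simp add: endo_scale[OF lin] endo_sum[OF lin] scale_sum_right comm add.commute del: of_nat_Suc)
  also have "\<dots> = (\<Sum>l\<le>k. \<Sum>n\<le>k - l. scale (of_nat (Suc m)) (scale (of_nat l) (S l (S n (?P m (k - l - n) v)))))"
    by (rule sum_triangle_swap)
  also have "\<dots> = scale (of_nat (Suc m)) (\<Sum>l\<le>k. scale (of_nat l) (S l (?P (Suc m) (k - l) v)))"
    by (simp add: ser_mult_def scale_sum_right endo_sum[OF lin] del: of_nat_Suc)
  finally show ?case
    by (simp only: of_nat_Suc[of "Suc m"] scale_left_distrib scale_one)
qed

lemma ser_power_low:
  assumes "\<And>n. endo (S n)" "\<And>v. S 0 v = 0" "k < m"
  shows "ser_power S m k v = 0"
  using assms(3)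
proof (induction m arbitrary: k)
  case (Suc m)
  have "S n (ser_power S m (k - n) v) = 0" if "n \<le> k" for n
    using Suc assms(2) that by (cases "n = 0") (auto simp: endo_zero[OF assms(1)])
  then show ?case
    by (simp add: ser_mult_def)
qed simp

text \<open>This is \<open>x (exp S)' = (x S') exp S\<close>, obtained by summing the chain rule over all powers.\<close>

lemma ser_exp_newton:
  assumes lin: "\<And>n. endo (S n)" and comm: "\<And>m n v. S m (S n v) = S n (S m v)"
    and S0: "\<And>v. S 0 v = 0"
  shows "ser_exp scale S = newton scale (\<lambda>n v. scale (of_nat n) (S n v))"
proof (rule newton_unique)
  fix v
  show "ser_exp scale S 0 v = v"
    by (simp add: ser_exp_def ser_one_def)
next
  fix k v
  let ?P = "ser_power S"
  have step: "scale (of_nat (Suc k)) (scale (1 / fact (Suc m)) (?P (Suc m) (Suc k) v))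
      = (\<Sum>n\<le>k. scale (of_nat (Suc n)) (S (Suc n) (scale (1 / fact m) (?P m (k - n) v))))" for m
  proof -
    have "scale (of_nat (Suc k)) (scale (1 / fact (Suc m)) (?P (Suc m) (Suc k) v))
        = scale (1 / fact (Suc m)) (scale (of_nat (Suc k)) (?P (Suc m) (Suc k) v))"
      by (simp only: scale_left_commute)
    also have "\<dots> = scale (1 / fact (Suc m) * of_nat (Suc m))
        (\<Sum>n\<le>Suc k. scale (of_nat n) (S n (?P m (Suc k - n) v)))"
      by (simp only: ser_power_newton[OF lin comm] scale_scale)
    also have "1 / fact (Suc m) * of_nat (Suc m) = (1 / fact m :: 'k)"
      using of_nat_neq_0[of m, where 'a='k] by (simp add: field_simps del: of_nat_Suc)
    also have "(\<Sum>n\<le>Suc k. scale (of_nat n) (S n (?P m (Suc k - n) v)))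
        = (\<Sum>n\<le>k. scale (of_nat (Suc n)) (S (Suc n) (?P m (k - n) v)))"
      by (simp only: sum.atMost_Suc_shift) simp
    finally show ?thesis
      by (simp only: scale_sum_right endo_scale[OF lin] scale_left_commute)
  qed
  have "scale (of_nat (Suc k)) (ser_exp scale S (Suc k) v)
      = (\<Sum>m\<le>k. scale (of_nat (Suc k)) (scale (1 / fact (Suc m)) (?P (Suc m) (Suc k) v)))"
    unfolding ser_exp_def sum.atMost_Suc_shift
    by (simp add: ser_one_def scale_right_distrib scale_sum_right del: of_nat_Suc fact_Suc ser_power.simps(2))
  also have "\<dots> = (\<Sum>n\<le>k. \<Sum>m\<le>k. scale (of_nat (Suc n)) (S (Suc n) (scale (1 / fact m) (?P m (k - n) v))))"
    unfolding step by (rule sum.swap)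
  also have "\<dots> = (\<Sum>n\<le>k. scale (of_nat (Suc n)) (S (Suc n) (ser_exp scale S (k - n) v)))"
  proof (rule sum.cong[OF refl])
    fix n
    \<comment> \<open>The powers with \<open>m > k - n\<close> start above degree \<open>k - n\<close>, so the cut-off of the
      exponential series may be lowered from \<open>k\<close> to \<open>k - n\<close>.\<close>
    have "(\<Sum>m\<le>k. scale (1 / fact m) (?P m (k - n) v)) = ser_exp scale S (k - n) v"
      unfolding ser_exp_def
      by (rule sum.mono_neutral_right) (auto intro!: ser_power_low lin S0)
    then show "(\<Sum>m\<le>k. scale (of_nat (Suc n)) (S (Suc n) (scale (1 / fact m) (?P m (k - n) v))))
        = scale (of_nat (Suc n)) (S (Suc n) (ser_exp scale S (k - n) v))"
      by (simp only: flip: scale_sum_right endo_sum[OF lin])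
  qed
  finally show "scale (of_nat (Suc k)) (ser_exp scale S (Suc k) v)
      = (\<Sum>n\<le>k. scale (of_nat (Suc n)) (S (Suc n) (ser_exp scale S (k - n) v)))" .
qed

lemma ser_exp_log_ser:
  assumes lin: "\<And>n. endo (A (Suc n))"
    and comm: "\<And>m n v. A (Suc m) (A (Suc n) v) = A (Suc n) (A (Suc m) v)"
  shows "ser_exp scale (log_ser scale A) = newton scale A"
proof -
  let ?S = "log_ser scale A"
  have S: "?S n = (\<lambda>v. if n = 0 then 0 else scale (1 / of_nat n) (A n v))" for n
    by (simp add: log_ser_def)
  have endoS: "endo (?S n)" for n
  proof (cases n)
    case 0
    then show ?thesis by (simp add: S endo_iff)
  next
    case (Suc m)
    then show ?thesis
      using endo_scaleI[OF lin[of m]] by (simp add: S del: of_nat_Suc)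
  qed
  have "?S m (?S n v) = ?S n (?S m v)" for m n v
    by (cases m; cases n)
      (simp_all add: S endo_scale[OF lin] endo_zero[OF lin] scale_left_commute comm del: of_nat_Suc)
  then have "ser_exp scale ?S = newton scale (\<lambda>n v. scale (of_nat n) (?S n v))"
    by (intro ser_exp_newton endoS) (simp_all add: S)
  also have "\<dots> = newton scale A"
  proof (rule newton_cong, rule ext)
    fix n v
    show "scale (of_nat (Suc n)) (?S (Suc n) v) = A (Suc n) v"
      using of_nat_neq_0[of n, where 'a='k] by (simp add: S del: of_nat_Suc)
  qed
  finally show ?thesis .
qed

lemma ser_exp_linear_nilpotent:
  assumes lin: "endo A" and sq: "\<And>v. A (A v) = 0"
  shows "ser_exp scale (ser_linear A) = (\<lambda>k v. if k = 0 then v else if k = 1 then A v else 0)"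
proof (intro ext)
  fix k v
  have pow: "ser_power (ser_linear A) m k v = (if k = m then (A ^^ m) v else 0)" for m k
  proof (induction m arbitrary: k)
    case 0
    show ?case by (simp add: ser_one_def)
  next
    case (Suc m)
    have "ser_power (ser_linear A) (Suc m) k v
        = (\<Sum>i\<le>k. if i = 1 then A (ser_power (ser_linear A) m (k - 1) v) else 0)"
      unfolding ser_power.simps ser_mult_def ser_linear_def by (intro sum.cong) auto
    then show ?case
      using Suc by (auto simp: endo_zero[OF lin])
  qed
  have "(A ^^ k) v = 0" if "k \<noteq> 0" "k \<noteq> 1"
  proof -
    from that obtain l where "k = Suc (Suc l)"
      by (metis One_nat_def not0_implies_Suc)
    then show ?thesis by (simp add: sq)
  qed
  then show "ser_exp scale (ser_linear A) k v = (if k = 0 then v else if k = 1 then A v else 0)"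
    by (auto simp: ser_exp_def pow if_distrib[of "scale _"] cong: if_cong)
qed

section \<open>Exchanging two exponentials\<close>

text \<open>If \<open>[P, N\<^sub>n] = m \<delta>\<^bsub>m,n\<^esub>\<close>, then \<open>P\<close> commutes with \<open>\<Sum>n\<ge>1. (y^n / n) N\<^sub>n\<close> up to the
  scalar \<open>y^m\<close>, hence with its exponential up to the factor \<open>y^m\<close>.  On coefficients: in
  \<open>[P, j B\<^sub>j] = \<Sum>n. [P, N\<^sub>n B\<^bsub>j-n\<^esub>]\<close> the commutators with \<open>N\<^sub>n\<close> give \<open>m B\<^bsub>j-m\<^esub>\<close>, and those
  with \<open>B\<^bsub>j-n\<^esub>\<close> give \<open>(j - m) B\<^bsub>j-m\<^esub>\<close> by the recurrence.\<close>

lemma newton_commutator: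
  assumes N: "\<And>n. endo (N (Suc n))" and P: "endo P" and m: "m > 0"
    and comm: "\<And>n v. P (N (Suc n) v) = N (Suc n) (P v) + (if Suc n = m then scale (of_nat m) v else 0)"
  shows "P (newton scale N j v) = newton scale N j (P v) + (if m \<le> j then newton scale N (j - m) v else 0)"
proof (induction j rule: less_induct)
  case (less j)
  let ?B = "newton scale N"
  show ?case
  proof (cases j)
    case 0
    then show ?thesis using m by simp
  next
    case (Suc k)
    have IH: "P (?B (k - n) v) = ?B (k - n) (P v) + (if m \<le> k - n then ?B (k - n - m) v else 0)" for n
      by (rule less) (use Suc in simp)
    have low: "(\<Sum>n\<le>k. N (Suc n) (if m \<le> k - n then ?B (k - n - m) v else 0))
        = (if m \<le> Suc k then scale (of_nat (Suc k - m)) (?B (Suc k - m) v) else 0)"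
    proof (cases "m \<le> k")
      case True
      then obtain d where d: "k = m + d"
        by (metis le_Suc_ex)
      have "(\<Sum>n\<le>k. N (Suc n) (if m \<le> k - n then ?B (k - n - m) v else 0))
          = (\<Sum>n\<le>d. N (Suc n) (?B (d - n) v))"
        unfolding d
        by (rule sum.mono_neutral_cong_right) (use m in \<open>auto simp: endo_zero[OF N] algebra_simps\<close>)
      also have "\<dots> = scale (of_nat (Suc d)) (?B (Suc d) v)"
        by (simp only: newton_rec)
      finally show ?thesis
        by (simp add: d Suc_diff_le del: newton.simps)
    next
      case False
      then show ?thesis
        by (auto simp: endo_zero[OF N] intro!: sum.neutral)
    qed
    have top: "(\<Sum>n\<le>k. if Suc n = m then scale (of_nat m) (?B (k - n) v) else 0)
        = (if m \<le> Suc k then scale (of_nat m) (?B (Suc k - m) v) else 0)"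
    proof -
      have "(\<Sum>n\<le>k. if Suc n = m then scale (of_nat m) (?B (k - n) v) else 0)
          = (\<Sum>n\<le>k. if n = m - 1 then scale (of_nat m) (?B (Suc k - m) v) else 0)"
        by (intro sum.cong) (use m in auto)
      then show ?thesis
        using m by (auto simp del: newton.simps)
    qed
    have "scale (of_nat (Suc k)) (P (?B (Suc k) v)) = P (\<Sum>n\<le>k. N (Suc n) (?B (k - n) v))"
      by (simp only: newton_rec flip: endo_scale[OF P])
    also have "\<dots> = (\<Sum>n\<le>k. N (Suc n) (?B (k - n) (P v))
        + N (Suc n) (if m \<le> k - n then ?B (k - n - m) v else 0)
        + (if Suc n = m then scale (of_nat m) (?B (k - n) v) else 0))"
      by (simp only: endo_sum[OF P] comm IH endo_add[OF N])
    also have "\<dots> = scale (of_nat (Suc k)) (?B (Suc k) (P v))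
        + (if m \<le> Suc k then scale (of_nat (Suc k - m)) (?B (Suc k - m) v) else 0)
        + (if m \<le> Suc k then scale (of_nat m) (?B (Suc k - m) v) else 0)"
      by (simp only: sum.distrib low top newton_rec)
    also have "\<dots> = scale (of_nat (Suc k)) (?B (Suc k) (P v) + (if m \<le> Suc k then ?B (Suc k - m) v else 0))"
    proof (cases "m \<le> Suc k")
      case True
      then have "of_nat (Suc k) = (of_nat (Suc k - m) + of_nat m :: 'k)"
        by (simp flip: of_nat_add)
      then show ?thesis
        using True by (simp only: if_True scale_right_distrib add.assoc flip: scale_left_distrib)
    qed simp
    finally show ?thesis
      using Suc scale_of_nat_cancel by blast
  qed
qed

text \<open>Moving \<open>P\<^sub>m\<close> to the right past \<open>D\<^sub>k\<close> raises the index by \<open>m\<close>.  In \<open>i C\<^sub>i D\<^sub>0\<close> the term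
  \<open>D\<^sub>k C\<^bsub>i-k\<^esub>\<close> arises with weight \<open>i - k\<close> from the \<open>P\<^sub>m\<close> that pass \<open>D\<^sub>k\<close> unchanged, by
  the recurrence, and once for each \<open>m = 1, \<dots>, k\<close> from \<open>D\<^bsub>k-m\<^esub>\<close>; the weights add up to \<open>i\<close>.\<close>

lemma newton_intertwine:
  assumes D: "\<And>k. endo (D k)"
    and comm: "\<And>m k v. P (Suc m) (D k v) = D k (P (Suc m) v) + D (k + Suc m) v"
    and P: "\<And>m. endo (P (Suc m))"
  shows "newton scale P i (D 0 v) = (\<Sum>k\<le>i. D k (newton scale P (i - k) v))"
proof (induction i rule: less_induct)
  case (less i)
  let ?C = "newton scale P"
  show ?case
  proof (cases i)
    case 0
    then show ?thesis by simp
  next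
    case (Suc p)
    have "scale (of_nat (Suc p)) (?C (Suc p) (D 0 v))
        = (\<Sum>m\<le>p. P (Suc m) (\<Sum>k\<le>p - m. D k (?C (p - m - k) v)))"
      unfolding newton_rec by (rule sum.cong[OF refl]) (use less Suc in simp)
    also have "\<dots> = (\<Sum>m\<le>p. \<Sum>k\<le>p - m. D k (P (Suc m) (?C (p - m - k) v)))
        + (\<Sum>m\<le>p. \<Sum>k\<le>p - m. D (k + Suc m) (?C (p - m - k) v))"
      by (simp only: endo_sum[OF P] comm sum.distrib)
    also have "(\<Sum>m\<le>p. \<Sum>k\<le>p - m. D k (P (Suc m) (?C (p - m - k) v)))
        = (\<Sum>k\<le>p. \<Sum>m\<le>p - k. D k (P (Suc m) (?C (p - k - m) v)))"
      by (subst sum_triangle_swap) (simp only: diff_commute)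
    also have "\<dots> = (\<Sum>k\<le>p. scale (of_nat (Suc p - k)) (D k (?C (Suc p - k) v)))"
      by (intro sum.cong refl)
        (simp only: endo_scale[OF D, symmetric] endo_sum[OF D, symmetric] newton_rec[symmetric]
          Suc_diff_le atMost_iff)
    also have "\<dots> = (\<Sum>k\<le>Suc p. scale (of_nat (Suc p - k)) (D k (?C (Suc p - k) v)))"
      by simp
    also have "(\<Sum>m\<le>p. \<Sum>k\<le>p - m. D (k + Suc m) (?C (p - m - k) v))
        = (\<Sum>l\<le>p. \<Sum>m\<le>l. D (Suc l) (?C (p - l) v))"
      by (subst sum_triangle_diagonals) (auto intro!: sum.cong)
    also have "\<dots> = (\<Sum>l\<le>p. scale (of_nat (Suc l)) (D (Suc l) (?C (Suc p - Suc l) v)))"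
    proof -
      have "(\<Sum>m\<le>l. u) = scale (of_nat (Suc l)) u" for l :: nat and u
        by (induction l) (simp_all only: sum.atMost_Suc of_nat_Suc[of "Suc _"] scale_left_distrib scale_one add.commute, simp)
      then show ?thesis
        by (simp only: diff_Suc_Suc)
    qed
    also have "\<dots> = (\<Sum>k\<le>Suc p. scale (of_nat k) (D k (?C (Suc p - k) v)))"
      by (simp only: sum.atMost_Suc_shift[of _ p]) simp
    also have "(\<Sum>k\<le>Suc p. scale (of_nat (Suc p - k)) (D k (?C (Suc p - k) v)))
          + (\<Sum>k\<le>Suc p. scale (of_nat k) (D k (?C (Suc p - k) v)))
        = (\<Sum>k\<le>Suc p. scale (of_nat (Suc p)) (D k (?C (Suc p - k) v)))"
      unfolding sum.distrib[symmetric]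
      by (intro sum.cong refl) (simp del: of_nat_Suc newton.simps flip: scale_left_distrib of_nat_add)
    also have "\<dots> = scale (of_nat (Suc p)) (\<Sum>k\<le>Suc p. D k (?C (Suc p - k) v))"
      by (simp only: scale_sum_right)
    finally show ?thesis
      using Suc scale_of_nat_cancel by blast
  qed
qed

lemma newton_exchange:
  assumes N: "\<And>n. endo (N (Suc n))" and P: "\<And>n. endo (P (Suc n))"
    and comm: "\<And>m n v. P (Suc m) (N (Suc n) v)
      = N (Suc n) (P (Suc m) v) + (if n = m then scale (of_nat (Suc m)) v else 0)"
  shows "newton scale P i (newton scale N j v) =
    (\<Sum>k\<le>i. if k \<le> j then newton scale N (j - k) (newton scale P (i - k) v) else 0)"
proof -
  \<comment> \<open>\<open>D k\<close> is the coefficient of index \<open>j - k\<close>, and zero where that index is negative, so that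
    raising \<open>k\<close> needs no case distinction.\<close>
  define D where "D = (\<lambda>k v. if k \<le> j then newton scale N (j - k) v else 0)"
  have D0: "D 0 = newton scale N j"
    by (simp add: D_def)
  have endoD: "endo (D k)" for k
    using newton_linear[of N, OF N] by (cases "k \<le> j") (simp_all add: D_def endo_iff)
  have "P (Suc m) (D k v) = D k (P (Suc m) v) + D (k + Suc m) v" for m k v
  proof (cases "k \<le> j")
    case True
    have "P (Suc m) (newton scale N (j - k) v) = newton scale N (j - k) (P (Suc m) v)
        + (if Suc m \<le> j - k then newton scale N (j - k - Suc m) v else 0)"
      by (rule newton_commutator) (auto simp: N P comm)
    then show ?thesis
      using True by (auto simp: D_def simp del: newton.simps)
  qed (auto simp: D_def endo_zero[OF P])
  from newton_intertwine[OF endoD this P] show ?thesis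
    unfolding D0 by (simp only: D_def)
qed

end

section \<open>Ordered products of exponentials along a chain\<close>

text \<open>Element \<open>i\<close> of \<open>X\<close> stands for the bond between the sites \<open>i - 1\<close> and \<open>i\<close>.  The jump from site
  \<open>i - n\<close> to site \<open>i\<close> crosses the bonds \<open>i - n + 1, \<dots>, i\<close>.  As \<open>X\<close> will always be an interval,
  it suffices to require the two outermost of them.\<close>

definition chain_shift ::
  "(int \<Rightarrow> 'v \<Rightarrow> 'v) \<Rightarrow> (int \<Rightarrow> 'v \<Rightarrow> 'v) \<Rightarrow> int set \<Rightarrow> nat \<Rightarrow> 'v::ab_group_add \<Rightarrow> 'v" where
  "chain_shift b c X n v =
     Sum_any (\<lambda>i. if i \<in> X \<and> i - int n + 1 \<in> X then b (- i) (c (i - int n) v) else 0)"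

lemma H_neg_eq_chain_shift: "H_neg b c = chain_shift b c UNIV"
  by (simp add: fun_eq_iff H_neg_def chain_shift_def)

lemma H_pos_eq_reflected_H_neg: "H_pos b c = H_neg (\<lambda>i. b (- i)) (\<lambda>i. c (- i))"
proof (intro ext)
  fix n v
  show "H_pos b c n v = H_neg (\<lambda>i. b (- i)) (\<lambda>i. c (- i)) n v"
    unfolding H_pos_def H_neg_def
  proof (rule Sum_any.reindex_cong[where l="\<lambda>i. int n - i"])
    show "bij (\<lambda>i. int n - i)"
      by (rule o_bij[where g="\<lambda>i. int n - i"]) (simp_all add: fun_eq_iff)
  qed (simp add: fun_eq_iff)
qed

context char0_vector_space
begin

lemma endo_Sum_any:
  assumes "endo g" "finite {i. f i \<noteq> 0}"
  shows "g (Sum_any f) = Sum_any (\<lambda>i. g (f i))"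
proof -
  have "Sum_any (\<lambda>i. g (f i)) = (\<Sum>i\<in>{i. f i \<noteq> 0}. g (f i))"
    by (rule Sum_any.expand_superset) (use assms endo_zero in auto)
  then show ?thesis
    by (simp add: Sum_any.expand_set endo_sum[OF assms(1)])
qed

lemma endo_Sum_anyI:
  assumes "\<And>i. endo (f i)" "\<And>v. finite {i. f i v \<noteq> 0}"
  shows "endo (\<lambda>v. Sum_any (\<lambda>i. f i v))"
proof (rule endoI)
  show "Sum_any (\<lambda>i. f i (u + v)) = Sum_any (\<lambda>i. f i u) + Sum_any (\<lambda>i. f i v)" for u v
    by (simp add: endo_add[OF assms(1)] Sum_any.distrib assms(2))
  show "Sum_any (\<lambda>i. f i (scale r v)) = scale r (Sum_any (\<lambda>i. f i v))" for r v
    using endo_Sum_any[of "scale r", OF _ assms(2)]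
    by (simp add: endo_scale[OF assms(1)] endo_iff scale_right_distrib scale_left_commute)
qed

end

text \<open>The last assumption makes the sums \<open>H\<^sub>n\<close> and \<open>H\<^bsub>-n\<^esub>\<close> finite on every vector.  All assumptions are
  stable under the reflection \<open>b(i), c(i) \<mapsto> b(-i), c(-i)\<close>, which the vacuum conditions are not.\<close>

locale fermions = char0_vector_space scale
  for scale :: "'k::field_char_0 \<Rightarrow> 'v::ab_group_add \<Rightarrow> 'v" +
  fixes b c :: "int \<Rightarrow> 'v \<Rightarrow> 'v"
  assumes linear_b: "endo (b i)"
    and linear_c: "endo (c i)"
    and anticomm_bc: "b i (c j v) + c j (b i v) = (if i = - j then v else 0)"
    and anticomm_bb: "b i (b j v) + b j (b i v) = 0"
    and anticomm_cc: "c i (c j v) + c j (c i v) = 0"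
    and locally_finite: "n \<noteq> 0 \<Longrightarrow> finite {i. b (- i) (c (i - n) v) \<noteq> 0}"
begin

lemma cb_eq: "c j (b i v) = (if i = - j then v else 0) - b i (c j v)"
  using anticomm_bc[of i j v] by (simp add: eq_diff_eq add.commute)

lemma bb_eq: "b i (b j v) = - b j (b i v)"
  using anticomm_bb[of i j v] by (simp add: eq_neg_iff_add_eq_0)

lemma cc_eq: "c i (c j v) = - c j (c i v)"
  using anticomm_cc[of i j v] by (simp add: eq_neg_iff_add_eq_0)

lemma bb_zero: "b i (b i v) = 0"
proof -
  have "scale (of_nat (Suc 1)) (b i (b i v)) = scale (of_nat (Suc 1)) 0"
    using anticomm_bb[of i i v] by (simp only: of_nat_Suc scale_left_distrib) simp
  then show ?thesis
    by (rule scale_of_nat_cancel)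
qed

lemma linear_hop: "endo (\<lambda>v. b i (c j v))"
  by (rule endo_compose[OF linear_b linear_c])

text \<open>The operators \<open>b(-i) c(j)\<close> commute like matrix units.\<close>

lemma hop_commutator:
  "b (- i) (c j (b (- k) (c l v))) = b (- k) (c l (b (- i) (c j v)))
     + (if j = k then b (- i) (c l v) else 0) - (if i = l then b (- k) (c j v) else 0)"
proof -
  have "b (- i) (b (- k) (c j (c l v))) = b (- k) (b (- i) (c l (c j v)))"
    by (simp add: bb_eq[of "- i"] cc_eq[of j] endo_neg[OF linear_b])
  moreover have "b (- i) (c j (b (- k) w)) = (if j = k then b (- i) w else 0) - b (- i) (b (- k) (c j w))" for i j k w
    by (auto simp: cb_eq endo_diff[OF linear_b] endo_zero[OF linear_b])
  ultimately show ?thesis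
    by (auto simp only:) auto
qed

lemma hop_into_occupied: "i \<noteq> j \<Longrightarrow> b (- i) (c j (b (- i) (c l v))) = 0"
  by (simp add: cb_eq endo_neg[OF linear_b] bb_zero)

lemma ser_exp_hop:
  assumes "i \<noteq> j"
  shows "ser_exp scale (ser_linear (b (- i) \<circ> c j)) =
    (\<lambda>k v. if k = 0 then v else if k = 1 then b (- i) (c j v) else 0)"
  using ser_exp_linear_nilpotent[OF linear_hop, of "- i" j] hop_into_occupied[OF assms]
  by (simp add: comp_def)

lemma additive_ser_exp_hop:
  assumes "i \<noteq> j"
  shows "Modules.additive (ser_exp scale (ser_linear (b (- i) \<circ> c j)) k)"
  unfolding ser_exp_hop[OF assms] by (simp add: Modules.additive_def endo_add[OF linear_hop])

lemma chain_support_finite: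
  "n > 0 \<Longrightarrow> finite {i. (if i \<in> X \<and> i - int n + 1 \<in> X then b (- i) (c (i - int n) v) else 0) \<noteq> 0}"
  by (rule finite_subset[OF _ locally_finite[of "int n" v]]) auto

lemma linear_chain_shift: "n > 0 \<Longrightarrow> endo (chain_shift b c X n)"
  unfolding chain_shift_def[abs_def]
  by (rule endo_Sum_anyI[OF _ chain_support_finite]) (auto simp: endo_iff linear_hop[unfolded endo_iff])

lemma chain_shift_interval:
  assumes "n > 0"
  shows "chain_shift b c {N..<M} n v = (\<Sum>i\<in>{N + int n - 1..<M}. b (- i) (c (i - int n) v))"
proof -
  have "chain_shift b c {N..<M} n v = (\<Sum>i\<in>{N + int n - 1..<M}.
      if i \<in> {N..<M} \<and> i - int n + 1 \<in> {N..<M} then b (- i) (c (i - int n) v) else 0)"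
    unfolding chain_shift_def by (rule Sum_any.expand_superset) auto
  also have "\<dots> = (\<Sum>i\<in>{N + int n - 1..<M}. b (- i) (c (i - int n) v))"
    using assms by (intro sum.cong) auto
  finally show ?thesis .
qed

lemma chain_shift_extend:
  assumes "n > 0" "N \<le> M"
  shows "chain_shift b c {N..<M + 1} n v =
    chain_shift b c {N..<M} n v + (if N \<le> M - int n + 1 then b (- M) (c (M - int n) v) else 0)"
proof (cases "N \<le> M - int n + 1")
  case True
  then have "{N + int n - 1..<M + 1} = insert M {N + int n - 1..<M}"
    using assms by auto
  then show ?thesis
    using True assms by (simp add: chain_shift_interval add.commute)
next
  case False
  then show ?thesis
    using assms by (simp add: chain_shift_interval)
qed

lemma hop_chain_shift:
  assumes "n > 0" "N \<le> M"
  shows "b (- M) (c (M - 1) (chain_shift b c {N..<M} n v)) =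
    chain_shift b c {N..<M} n (b (- M) (c (M - 1) v))
      + (if N \<le> M - int n then b (- M) (c (M - int (Suc n)) v) else 0)"
proof -
  have "b (- M) (c (M - 1) (chain_shift b c {N..<M} n v))
      = (\<Sum>i\<in>{N + int n - 1..<M}. b (- i) (c (i - int n) (b (- M) (c (M - 1) v)))
          + (if i = M - 1 then b (- M) (c (M - int (Suc n)) v) else 0))"
    unfolding chain_shift_interval[OF assms(1)] endo_sum[OF linear_hop]
    by (intro sum.cong refl, subst hop_commutator) (use assms in \<open>auto simp: algebra_simps\<close>)
  also have "\<dots> = chain_shift b c {N..<M} n (b (- M) (c (M - 1) v))
      + (if N \<le> M - int n then b (- M) (c (M - int (Suc n)) v) else 0)"
    unfolding sum.distrib chain_shift_interval[OF assms(1)]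
    using assms by (simp add: sum.delta)
  finally show ?thesis .
qed

text \<open>Multiplying a solution \<open>q\<close> for the chain of bonds \<open>N, \<dots>, M - 1\<close> by \<open>1 + x A\<close> with
  \<open>A = b(-M) c(M-1)\<close> gives a solution for the chain that also contains bond \<open>M\<close>.  Let \<open>h\<^sub>n\<close> be the jumps of
  length \<open>n\<close> along the old chain and \<open>g\<^sub>n\<close> the one new jump of length \<open>n\<close>, which ends at site \<open>M\<close>.
  The proof uses three facts: \<open>g\<^sub>1 = A\<close>; a short new jump following an old jump makes a longer new jump,
  \<open>[A, h\<^sub>n] = g\<^bsub>n+1\<^esub>\<close>; and \<open>g\<^sub>n A = 0\<close>, since both move a fermion to site \<open>M\<close>.\<close>

lemma newton_chain_extend:
  assumes "N \<le> M"
    and rec: "\<And>k. scale (of_nat (Suc k)) (q (Suc k)) = (\<Sum>n\<le>k. chain_shift b c {N..<M} (Suc n) (q (k - n)))"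
    and q'0: "q' 0 = q 0" and q'Suc: "\<And>k. q' (Suc k) = q (Suc k) + b (- M) (c (M - 1) (q k))"
  shows "scale (of_nat (Suc k)) (q' (Suc k)) = (\<Sum>n\<le>k. chain_shift b c {N..<M + 1} (Suc n) (q' (k - n)))"
proof -
  define A where "A v = b (- M) (c (M - 1) v)" for v
  define h where "h n = chain_shift b c {N..<M} n" for n
  define g where "g n v = (if N \<le> M - int n + 1 then b (- M) (c (M - int n) v) else 0)" for n v
  have A: "endo A"
    unfolding A_def[abs_def] by (rule linear_hop)
  have h: "endo (h (Suc n))" for n
    unfolding h_def by (rule linear_chain_shift) simp
  have g: "endo (g n)" for n
    unfolding g_def[abs_def] by (auto simp: endo_iff linear_hop[unfolded endo_iff])
  have Ah: "A (h (Suc n) v) = h (Suc n) (A v) + g (Suc (Suc n)) v" for n v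
    using hop_chain_shift[OF _ assms(1), of "Suc n" v]
    by (simp add: A_def h_def g_def algebra_simps)
  have gA: "g (Suc n) (A v) = 0" for n v
    using hop_into_occupied[of M "M - int (Suc n)" "M - 1" v] by (simp add: A_def g_def)
  have g1: "g (Suc 0) v = A v" for v
    using assms(1) by (simp add: g_def A_def)
  have h': "chain_shift b c {N..<M + 1} (Suc n) v = h (Suc n) v + g (Suc n) v" for n v
    unfolding h_def g_def using chain_shift_extend[OF _ assms(1), of "Suc n" v] by simp
  note rec = rec[folded h_def]
  note q'Suc = q'Suc[folded A_def]
  show ?thesis
  proof (cases k)
    case 0
    then show ?thesis
      using rec[of 0] by (simp add: q'Suc q'0 h' g1)
  next
    case (Suc p)
    have q': "h (Suc n) (q' (Suc p - n)) + g (Suc n) (q' (Suc p - n))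
        = h (Suc n) (q (Suc p - n)) + g (Suc n) (q (Suc p - n)) + h (Suc n) (A (q (p - n)))"
      if "n \<le> p" for n
      using that by (simp add: Suc_diff_le q'Suc endo_add[OF h] endo_add[OF g] gA algebra_simps)
    have "(\<Sum>n\<le>Suc p. chain_shift b c {N..<M + 1} (Suc n) (q' (Suc p - n)))
        = (\<Sum>n\<le>p. h (Suc n) (q (Suc p - n)) + g (Suc n) (q (Suc p - n)) + h (Suc n) (A (q (p - n))))
          + (h (Suc (Suc p)) (q 0) + g (Suc (Suc p)) (q 0))"
      by (simp add: h' q' q'0)
    also have "\<dots> = (\<Sum>n\<le>Suc p. h (Suc n) (q (Suc p - n))) + (\<Sum>n\<le>Suc p. g (Suc n) (q (Suc p - n)))
        + (\<Sum>n\<le>p. h (Suc n) (A (q (p - n))))"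
      by (simp add: sum.distrib algebra_simps)
    also have "(\<Sum>n\<le>Suc p. g (Suc n) (q (Suc p - n))) = A (q (Suc p)) + (\<Sum>n\<le>p. g (Suc (Suc n)) (q (p - n)))"
      by (simp only: sum.atMost_Suc_shift g1 diff_Suc_Suc diff_zero)
    also have "(\<Sum>n\<le>Suc p. h (Suc n) (q (Suc p - n)))
        + (A (q (Suc p)) + (\<Sum>n\<le>p. g (Suc (Suc n)) (q (p - n)))) + (\<Sum>n\<le>p. h (Suc n) (A (q (p - n))))
      = (\<Sum>n\<le>Suc p. h (Suc n) (q (Suc p - n))) + A (q (Suc p)) + A (\<Sum>n\<le>p. h (Suc n) (q (p - n)))"
      by (simp only: endo_sum[OF A] Ah sum.distrib add_ac)
    also have "\<dots> = scale (of_nat (Suc (Suc p))) (q (Suc (Suc p))) + A (q (Suc p)) + A (scale (of_nat (Suc p)) (q (Suc p)))"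
      by (simp only: rec)
    also have "\<dots> = scale (of_nat (Suc (Suc p))) (q' (Suc (Suc p)))"
      by (simp only: q'Suc endo_scale[OF A] scale_right_distrib of_nat_Suc[of "Suc p"]
          scale_left_distrib[of 1 "of_nat (Suc p)" "A _"] scale_one add_ac)
    finally show ?thesis
      by (simp only: Suc)
  qed
qed

lemma prod_exp_hop:
  "prod_left (\<lambda>k. ser_exp scale (ser_linear (b (- (N + int k)) \<circ> c (N + int k - 1)))) K
     = newton scale (chain_shift b c {N..<N + int K})"
proof (rule newton_unique)
  define E where "E k = ser_exp scale (ser_linear (b (- (N + int k)) \<circ> c (N + int k - 1)))" for k
  have E: "E k = (\<lambda>l v. if l = 0 then v else if l = 1 then b (- (N + int k)) (c (N + int k - 1) v) else 0)"
    for k unfolding E_def by (rule ser_exp_hop) simp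
  have P0: "prod_left E (Suc K) 0 v = prod_left E K 0 v" for K v
    by (simp add: ser_mult_def E)
  have PSuc: "prod_left E (Suc K) (Suc k) v
      = prod_left E K (Suc k) v + b (- (N + int K)) (c (N + int K - 1) (prod_left E K k v))" for K k v
  proof -
    have "(\<Sum>i\<le>k. E K (Suc i) (prod_left E K (k - i) v))
        = (\<Sum>i\<le>k. if i = 0 then b (- (N + int K)) (c (N + int K - 1) (prod_left E K k v)) else 0)"
      unfolding E by (rule sum.cong) auto
    then show ?thesis
      unfolding prod_left.simps ser_mult_def sum.atMost_Suc_shift[of _ k]
      by (simp add: E)
  qed
  show "prod_left E K 0 v = v" for v
    by (induction K) (simp_all only: P0, simp add: ser_one_def)
  show "scale (of_nat (Suc k)) (prod_left E K (Suc k) v)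
      = (\<Sum>n\<le>k. chain_shift b c {N..<N + int K} (Suc n) (prod_left E K (k - n) v))" for k v
  proof (induction K arbitrary: k)
    case 0
    have "chain_shift b c {} n w = 0" for n w
      by (simp add: chain_shift_def)
    then show ?case
      by (simp add: ser_one_def)
  next
    case (Suc K)
    have "N + int (Suc K) = N + int K + 1"
      by simp
    then show ?case
      using newton_chain_extend[where q="\<lambda>k. prod_left E K k v" and q'="\<lambda>k. prod_left E (Suc K) k v"
          and M="N + int K" and N=N, OF _ Suc P0 PSuc]
      by (simp only:)
  qed
qed

text \<open>On a given vector only finitely many jumps of a given length act, so it is enough that each
  single bond is eventually in or out for good.\<close>

lemma newton_chain_tendsto:
  assumes "\<And>i. \<forall>\<^sub>F K in sequentially. i \<in> X K \<longleftrightarrow> i \<in> Y"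
  shows "ser_tendsto (\<lambda>K. newton scale (chain_shift b c (X K))) (newton scale (chain_shift b c Y))"
  unfolding ser_tendsto_def
proof (intro allI newton_eventually_eq)
  fix n v
  define I where "I = {i. b (- i) (c (i - int (Suc n)) v) \<noteq> 0}"
  have "finite I"
    unfolding I_def by (rule locally_finite) simp
  then have "\<forall>\<^sub>F K in sequentially. \<forall>i\<in>I. (i \<in> X K \<longleftrightarrow> i \<in> Y)
      \<and> (i - int (Suc n) + 1 \<in> X K \<longleftrightarrow> i - int (Suc n) + 1 \<in> Y)"
    by (intro eventually_ball_finite ballI eventually_conj assms)
  then show "\<forall>\<^sub>F K in sequentially. chain_shift b c (X K) (Suc n) v = chain_shift b c Y (Suc n) v"
  proof (rule eventually_mono)
    fix K
    assume "\<forall>i\<in>I. (i \<in> X K \<longleftrightarrow> i \<in> Y)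
      \<and> (i - int (Suc n) + 1 \<in> X K \<longleftrightarrow> i - int (Suc n) + 1 \<in> Y)"
    then show "chain_shift b c (X K) (Suc n) v = chain_shift b c Y (Suc n) v"
      unfolding chain_shift_def I_def by (intro Sum_any.cong) auto
  qed
qed

text \<open>For fixed \<open>M\<close> the bonds are \<open>M - 1, M - 2, \<dots>\<close>, and the partial products let the lower end of
  the chain go down.\<close>

lemma opB_eq_newton: "opB scale b c M = newton scale (chain_shift b c {..<int M})"
proof -
  define E where "E k = ser_exp scale (ser_linear (b (- (int M - int k - 1)) \<circ> c (int M - int k - 2)))" for k
  have "prod_right E K = newton scale (chain_shift b c {int M - int K..<int M})" for K
  proof -
    have "prod_right E K = prod_left (\<lambda>k. E (K - 1 - k)) K"
      unfolding E_def by (rule prod_right_eq_prod_left) (rule additive_ser_exp_hop, simp)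
    also have "\<dots> = prod_left (\<lambda>k. ser_exp scale (ser_linear
        (b (- (int M - int K + int k)) \<circ> c (int M - int K + int k - 1)))) K"
    proof (rule prod_left_cong)
      fix k
      assume "k < K"
      then have "int M - int (K - 1 - k) - 1 = int M - int K + int k"
        "int M - int (K - 1 - k) - 2 = int M - int K + int k - 1"
        by auto
      then show "E (K - 1 - k) = ser_exp scale (ser_linear
          (b (- (int M - int K + int k)) \<circ> c (int M - int K + int k - 1)))"
        by (simp only: E_def)
    qed
    also have "\<dots> = newton scale (chain_shift b c {int M - int K..<int M})"
      by (subst prod_exp_hop) simp
    finally show ?thesis .
  qed
  moreover have "\<forall>\<^sub>F K in sequentially. i \<in> {int M - int K..<int M} \<longleftrightarrow> i \<in> {..<int M}" for i
    by (rule eventually_sequentiallyI[of "nat (int M - i)"]) auto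
  ultimately have "ser_tendsto (prod_right E) (newton scale (chain_shift b c {..<int M}))"
    using newton_chain_tendsto[of "\<lambda>K. {int M - int K..<int M}" "{..<int M}"] by presburger
  then show ?thesis
    unfolding opB_def Let_def E_def by (simp add: ser_lim_eq)
qed

lemma opB_tendsto: "ser_tendsto (\<lambda>M. opB scale b c M) (newton scale (H_neg b c))"
  unfolding opB_eq_newton H_neg_eq_chain_shift
  by (rule newton_chain_tendsto, rule_tac c="nat (i + 1)" in eventually_sequentiallyI) auto

text \<open>Reflection turns the factor of \<open>\<^bold>C\<close> with index \<open>M - k\<close> into that of bond \<open>2 - M + k\<close>.  So the
  lower end \<open>2 - M\<close> of the chain is fixed, and the factors are multiplied from the left in the order of
  increasing bonds, just as in a finite product for \<open>\<^bold>B\<close>.\<close>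

lemma reflected_opC_eq_newton:
  "opC scale (\<lambda>i. b (- i)) (\<lambda>i. c (- i)) M = newton scale (chain_shift b c {2 - int M..})"
proof -
  define E where "E k = ser_exp scale (ser_linear (b (- (2 - int M + int k)) \<circ> c (2 - int M + int k - 1)))" for k
  have "\<forall>\<^sub>F K in sequentially. i \<in> {2 - int M..<2 - int M + int K} \<longleftrightarrow> i \<in> {2 - int M..}" for i
    by (rule eventually_sequentiallyI[of "nat (i + int M)"]) auto
  then have "ser_tendsto (prod_left E) (newton scale (chain_shift b c {2 - int M..}))"
    unfolding E_def prod_exp_hop by (rule newton_chain_tendsto)
  moreover have "opC scale (\<lambda>i. b (- i)) (\<lambda>i. c (- i)) M = ser_lim (prod_left E)"
    unfolding opC_def Let_def E_def by (simp add: algebra_simps)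
  ultimately show ?thesis
    by (simp add: ser_lim_eq)
qed

lemma reflected_opC_tendsto:
  "ser_tendsto (\<lambda>M. opC scale (\<lambda>i. b (- i)) (\<lambda>i. c (- i)) M) (newton scale (H_neg b c))"
  unfolding reflected_opC_eq_newton H_neg_eq_chain_shift
  by (rule newton_chain_tendsto, rule_tac c="nat (2 - i)" in eventually_sequentiallyI) auto

end

section \<open>The Heisenberg algebra on the Fock space\<close>

context vector_space
begin

text \<open>The Heisenberg anomaly.  If \<open>g\<close> were finitely supported, the sum would vanish by reindexing; but
  \<open>g\<close> tends to \<open>w\<close> on the left, and each unit of shift telescopes to one copy of \<open>w\<close>.\<close>

lemma sum_shift_difference:
  fixes g :: "int \<Rightarrow> 'b"
  assumes right: "\<And>j. j \<ge> R \<Longrightarrow> g j = 0" and left: "\<And>j. j \<le> - R \<Longrightarrow> g j = w"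
    and "B \<ge> R + \<bar>m\<bar>" "B \<ge> 0"
  shows "(\<Sum>j\<in>{- B..<B}. g (j - m) - g j) = scale (of_int m) w"
proof -
  have one: "(\<Sum>j\<in>{- B..<B}. f (j - 1) - f j) = f (- B - 1) - f (B - 1)"
    for f :: "int \<Rightarrow> 'b"
  proof -
    have "(\<Sum>j\<in>{- B..<- B + int n}. f (j - 1) - f j) = f (- B - 1) - f (- B + int n - 1)" for n
    proof (induction n)
      case (Suc n)
      have "{- B..<- B + int (Suc n)} = insert (- B + int n) {- B..<- B + int n}"
        by auto
      then show ?case
        using Suc by simp
    qed simp
    from this[of "nat (2 * B)"] show ?thesis
      using \<open>B \<ge> 0\<close> by simp
  qed
  show ?thesis
    using \<open>B \<ge> R + \<bar>m\<bar>\<close>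
  proof (induction m rule: int_induct[where k=0])
    case base
    show ?case by simp
  next
    case (step1 m)
    have "(\<Sum>j\<in>{- B..<B}. g (j - (m + 1)) - g j)
        = (\<Sum>j\<in>{- B..<B}. g (j - 1 - m) - g (j - m)) + (\<Sum>j\<in>{- B..<B}. g (j - m) - g j)"
      by (simp add: algebra_simps flip: sum.distrib)
    also have "(\<Sum>j\<in>{- B..<B}. g (j - 1 - m) - g (j - m)) = g (- B - 1 - m) - g (B - 1 - m)"
      by (rule one)
    also have "\<dots> = w"
      using left[of "- B - 1 - m"] right[of "B - 1 - m"] step1 by simp
    also have "(\<Sum>j\<in>{- B..<B}. g (j - m) - g j) = scale (of_int m) w"
      using step1 by simp
    finally show ?case
      by (simp add: scale_left_distrib add.commute)
  next
    case (step2 m)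
    have "(\<Sum>j\<in>{- B..<B}. g (j - (m - 1)) - g j)
        = (\<Sum>j\<in>{- B..<B}. g (j - m) - g j) - (\<Sum>j\<in>{- B..<B}. g (j - 1 - (m - 1)) - g (j - (m - 1)))"
      by (simp add: algebra_simps flip: sum_subtractf)
    also have "(\<Sum>j\<in>{- B..<B}. g (j - 1 - (m - 1)) - g (j - (m - 1)))
        = g (- B - 1 - (m - 1)) - g (B - 1 - (m - 1))"
      by (rule one)
    also have "\<dots> = w"
      using left[of "- B - 1 - (m - 1)"] right[of "B - 1 - (m - 1)"] step2 by simp
    also have "(\<Sum>j\<in>{- B..<B}. g (j - m) - g j) = scale (of_int m) w"
      using step2 by simp
    finally show ?case
      by (simp add: scale_left_diff_distrib)
  qed
qed

end

context fock_space
begin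

text \<open>The vectors killed by all modes of sufficiently large index form a subspace that contains the
  vacuum.  It is stable under \<open>b(i)\<close> and \<open>c(i)\<close>, because a mode of index above \<open>- i\<close> anticommutes
  with both.\<close>

lemma annihilation_bound:
  obtains R where "R > 0" "\<And>i. i \<ge> R \<Longrightarrow> b i v = 0" "\<And>i. i \<ge> R \<Longrightarrow> c i v = 0"
proof -
  interpret char0_vector_space scale ..
  define S where "S = {v. \<exists>R. \<forall>i\<ge>R. b i v = 0 \<and> c i v = 0}"
  have "S = UNIV"
  proof (rule vac_generates)
    show "subspace S"
    proof (rule subspaceI)
      show "0 \<in> S"
        by (simp add: S_def endo_zero[OF linear_b] endo_zero[OF linear_c])
    next
      fix u v
      assume "u \<in> S" "v \<in> S"
      then obtain R1 R2 where "\<forall>i\<ge>R1. b i u = 0 \<and> c i u = 0" "\<forall>i\<ge>R2. b i v = 0 \<and> c i v = 0"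
        by (auto simp: S_def)
      then show "u + v \<in> S"
        unfolding S_def
        by (auto simp: endo_add[OF linear_b] endo_add[OF linear_c] intro!: exI[of _ "max R1 R2"])
    next
      fix r v
      assume "v \<in> S"
      then show "scale r v \<in> S"
        unfolding S_def by (fastforce simp: endo_scale[OF linear_b] endo_scale[OF linear_c])
    qed
  next
    have "b i vac = 0 \<and> c i vac = 0" if "i \<ge> 1" for i
      using b_vac[of "i - 1"] c_vac[of i] that by simp
    then show "vac \<in> S"
      unfolding S_def by blast
  next
    fix i v
    assume "v \<in> S"
    then obtain R where R: "\<And>j. j \<ge> R \<Longrightarrow> b j v = 0 \<and> c j v = 0"
      by (auto simp: S_def)
    have "b j (b i v) = 0 \<and> c j (b i v) = 0 \<and> b j (c i v) = 0 \<and> c j (c i v) = 0"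
      if "j \<ge> max R (1 - i)" for j
    proof -
      from that have "j \<ge> R" "i \<noteq> - j"
        by auto
      then show ?thesis
        using R[of j] anticomm_bb[of j i v] anticomm_cc[of j i v] anticomm_bc[of i j v] anticomm_bc[of j i v]
          endo_zero[OF linear_b] endo_zero[OF linear_c] by auto
    qed
    then show "b i v \<in> S" "c i v \<in> S"
      unfolding S_def by blast+
  qed
  then obtain R where "\<forall>i\<ge>R. b i v = 0 \<and> c i v = 0"
    by (auto simp: S_def)
  then show thesis
    by (intro that[of "max R 1"]) auto
qed

lemma hop_support:
  assumes "\<And>i. i \<ge> R \<Longrightarrow> b i v = 0" "\<And>i. i \<ge> R \<Longrightarrow> c i v = 0" "n \<noteq> 0"
  shows "{i. b (- i) (c (i + n) v) \<noteq> 0} \<subseteq> {- R<..<R - n}"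
proof (rule subsetI, rule ccontr)
  fix i
  assume "i \<in> {i. b (- i) (c (i + n) v) \<noteq> 0}" and "i \<notin> {- R<..<R - n}"
  then consider "b (- i) (c (i + n) v) \<noteq> 0" "- i \<ge> R" | "b (- i) (c (i + n) v) \<noteq> 0" "i + n \<ge> R"
    by force
  then show False
  proof cases
    case 1
    then show False
      using anticomm_bc[of "- i" "i + n" v] assms module_hom.zero[of scale scale "c (i + n)"] linear_c
      by (simp add: module_hom_iff_linear)
  next
    case 2
    then show False
      using assms module_hom.zero[of scale scale "b (- i)"] linear_b
      by (simp add: module_hom_iff_linear)
  qed
qed

lemma hop_locally_finite: "n \<noteq> 0 \<Longrightarrow> finite {i. b (- i) (c (i + n) v) \<noteq> 0}"
  by (rule annihilation_bound[of v]) (rule finite_subset[OF hop_support], auto)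

sublocale fermions scale b c
proof (intro fermions.intro fermions_axioms.intro)
  show "char0_vector_space scale" ..
  show "finite {i. b (- i) (c (i - n) v) \<noteq> 0}" if "n \<noteq> 0" for n v
    using hop_locally_finite[of "- n" v] that by simp
qed (simp_all add: linear_b linear_c anticomm_bc anticomm_bb anticomm_cc)

sublocale reflected: fermions scale "\<lambda>i. b (- i)" "\<lambda>i. c (- i)"
proof (intro fermions.intro fermions_axioms.intro)
  show "char0_vector_space scale" ..
  show "finite {i. b (- (- i)) (c (- (i - n)) v) \<noteq> 0}" if "n \<noteq> 0" for n v
  proof -
    have "{i. b (- (- i)) (c (- (i - n)) v) \<noteq> 0} = uminus -` {i. b (- i) (c (i + n) v) \<noteq> 0}"
      by (simp add: vimage_def)
    then show ?thesis
      using finite_vimageI[OF hop_locally_finite[OF that, of v], of uminus] by simp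
  qed
qed (simp_all add: linear_b linear_c anticomm_bc anticomm_bb anticomm_cc equation_minus_iff)

text \<open>A common indexing by all integers: \<open>current n\<close> is \<open>H\<^sub>n\<close>, for negative \<open>n\<close> as well.\<close>

definition current :: "int \<Rightarrow> 'v \<Rightarrow> 'v" where
  "current m v = Sum_any (\<lambda>i. b (- i) (c (i + m) v))"

lemma H_neg_eq_current: "H_neg b c n = current (- int n)"
  by (simp add: fun_eq_iff H_neg_def current_def)

lemma H_pos_eq_current: "H_pos b c n = current (int n)"
proof
  fix v
  show "H_pos b c n v = current (int n) v"
    unfolding H_pos_def current_def
  proof (rule Sum_any.reindex_cong[where l="\<lambda>i. i + int n"])
    show "bij (\<lambda>i. i + int n)"
      by (rule o_bij[where g="\<lambda>i. i - int n"]) (simp_all add: fun_eq_iff)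
  qed (simp add: fun_eq_iff)
qed

lemma linear_current: "m \<noteq> 0 \<Longrightarrow> endo (current m)"
  unfolding current_def[abs_def] by (rule endo_Sum_anyI[OF linear_hop hop_locally_finite])

lemma current_b:
  assumes "m \<noteq> 0"
  shows "current m (b (- j) v) = b (- j) (current m v) + b (- (j - m)) v"
proof -
  have "current m (b (- j) v)
      = Sum_any (\<lambda>i. b (- j) (b (- i) (c (i + m) v)) + (if i = j - m then b (- i) v else 0))"
    unfolding current_def
  proof (rule Sum_any.cong)
    fix i
    have "b (- i) (b (- j) (c (i + m) v)) = - b (- j) (b (- i) (c (i + m) v))"
      by (rule bb_eq)
    then show "b (- i) (c (i + m) (b (- j) v))
        = b (- j) (b (- i) (c (i + m) v)) + (if i = j - m then b (- i) v else 0)"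
      by (auto simp: cb_eq endo_diff[OF linear_b] endo_zero[OF linear_b])
  qed
  also have "\<dots> = Sum_any (\<lambda>i. b (- j) (b (- i) (c (i + m) v))) + Sum_any (\<lambda>i. if i = j - m then b (- i) v else 0)"
    by (rule Sum_any.distrib)
      (rule finite_subset[OF _ hop_locally_finite[OF assms, of v]], auto simp: endo_zero[OF linear_b])
  also have "\<dots> = b (- j) (current m v) + b (- (j - m)) v"
    unfolding current_def endo_Sum_any[OF linear_b hop_locally_finite[OF assms]] by simp
  finally show ?thesis .
qed

lemma current_c:
  assumes "m \<noteq> 0"
  shows "current m (c j v) = c j (current m v) - c (j + m) v"
proof -
  have "current m (c j v)
      = Sum_any (\<lambda>i. c j (b (- i) (c (i + m) v)) + (if i = j then - c (i + m) v else 0))"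
    unfolding current_def
  proof (rule Sum_any.cong)
    fix i
    have "b (- i) (c (i + m) (c j v)) = - b (- i) (c j (c (i + m) v))"
      by (subst cc_eq) (rule endo_neg[OF linear_b])
    then show "b (- i) (c (i + m) (c j v))
        = c j (b (- i) (c (i + m) v)) + (if i = j then - c (i + m) v else 0)"
      by (auto simp: cb_eq)
  qed
  also have "\<dots> = Sum_any (\<lambda>i. c j (b (- i) (c (i + m) v))) + Sum_any (\<lambda>i. if i = j then - c (i + m) v else 0)"
    by (rule Sum_any.distrib)
      (rule finite_subset[OF _ hop_locally_finite[OF assms, of v]], auto simp: endo_zero[OF linear_c])
  also have "\<dots> = c j (current m v) - c (j + m) v"
    unfolding current_def endo_Sum_any[OF linear_c hop_locally_finite[OF assms]] by simp
  finally show ?thesis .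
qed

text \<open>By \<open>current_b\<close> and \<open>current_c\<close>, commuting \<open>H\<^sub>m\<close> with the summand \<open>b(-j) c(j+n)\<close> of \<open>H\<^sub>n\<close> leaves
  \<open>g(j - m) - g(j)\<close> with \<open>g(j) = b(-j) c(j+m+n)\<close>.  On a vector \<open>v\<close>, \<open>g\<close> vanishes far to the
  right; far to the left, \<open>b(-j)\<close> kills \<open>v\<close>, and the anticommutator leaves \<open>v\<close> if \<open>m + n = 0\<close> and
  nothing otherwise.\<close>

lemma current_commutator:
  assumes "m \<noteq> 0" "n \<noteq> 0"
  shows "current m (current n v) = current n (current m v) + (if m + n = 0 then scale (of_int m) v else 0)"
proof -
  let ?w = "current m v"
  obtain R1 where R1: "R1 > 0" "\<And>i. i \<ge> R1 \<Longrightarrow> b i v = 0" "\<And>i. i \<ge> R1 \<Longrightarrow> c i v = 0"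
    by (rule annihilation_bound[of v]) blast
  obtain R2 where R2: "R2 > 0" "\<And>i. i \<ge> R2 \<Longrightarrow> b i ?w = 0" "\<And>i. i \<ge> R2 \<Longrightarrow> c i ?w = 0"
    by (rule annihilation_bound[of ?w]) blast
  \<comment> \<open>Both infinite sums are restricted to one finite window, so that the differences of \<open>g\<close> can be
    summed without separating the two terms: for \<open>m + n = 0\<close>, neither is finitely supported.\<close>
  define R where "R = R1 + \<bar>m\<bar> + \<bar>n\<bar>"
  define B where "B = R + R2 + \<bar>m\<bar>"
  have v: "current n v = (\<Sum>j\<in>{- B..<B}. b (- j) (c (j + n) v))"
    unfolding current_def
  proof (rule Sum_any.expand_superset)
    show "{j. b (- j) (c (j + n) v) \<noteq> 0} \<subseteq> {- B..<B}"
      by (rule subset_trans[OF hop_support[OF R1(2,3) assms(2)]]) (use R2(1) in \<open>auto simp: B_def R_def\<close>)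
  qed simp
  have w: "current n ?w = (\<Sum>j\<in>{- B..<B}. b (- j) (c (j + n) ?w))"
    unfolding current_def[of n]
  proof (rule Sum_any.expand_superset)
    show "{j. b (- j) (c (j + n) ?w) \<noteq> 0} \<subseteq> {- B..<B}"
      by (rule subset_trans[OF hop_support[OF R2(2,3) assms(2)]]) (use R1(1) in \<open>auto simp: B_def R_def\<close>)
  qed simp
  define g where "g j = b (- j) (c (j + (m + n)) v)" for j
  have "current m (current n v) = (\<Sum>j\<in>{- B..<B}. b (- j) (c (j + n) ?w) + (g (j - m) - g j))"
    unfolding v endo_sum[OF linear_current[OF assms(1)]]
    by (intro sum.cong refl)
      (simp add: current_b[OF assms(1)] current_c[OF assms(1)] endo_diff[OF linear_b] g_def algebra_simps)
  also have "\<dots> = current n ?w + (\<Sum>j\<in>{- B..<B}. g (j - m) - g j)"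
    by (simp only: sum.distrib w)
  also have "(\<Sum>j\<in>{- B..<B}. g (j - m) - g j) = scale (of_int m) (if m + n = 0 then v else 0)"
  proof (rule sum_shift_difference[where R=R])
    fix j
    show "g j = 0" if "j \<ge> R"
    proof -
      have "c (j + (m + n)) v = 0"
        by (rule R1) (use that in \<open>auto simp: R_def\<close>)
      then show ?thesis by (simp add: g_def endo_zero[OF linear_b])
    qed
    show "g j = (if m + n = 0 then v else 0)" if "j \<le> - R"
    proof -
      have "b (- j) v = 0"
        by (rule R1) (use that in \<open>auto simp: R_def\<close>)
      then show ?thesis
        using anticomm_bc[of "- j" "j + (m + n)" v] by (auto simp: g_def endo_zero[OF linear_c])
    qed
  qed (use R1(1) R2(1) in \<open>auto simp: B_def R_def\<close>)
  finally show ?thesis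
    by simp
qed

lemma linear_H_neg: "endo (H_neg b c (Suc n))"
  unfolding H_neg_eq_current by (rule linear_current) simp

lemma linear_H_pos: "endo (H_pos b c (Suc n))"
  unfolding H_pos_eq_current by (rule linear_current) simp

lemma ser_exp_H_neg: "ser_exp scale (log_ser scale (H_neg b c)) = newton scale (H_neg b c)"
  by (rule ser_exp_log_ser[of "H_neg b c", OF linear_H_neg]) (unfold H_neg_eq_current, subst current_commutator, simp_all)

lemma ser_exp_H_pos: "ser_exp scale (log_ser scale (H_pos b c)) = newton scale (H_pos b c)"
  by (rule ser_exp_log_ser[of "H_pos b c", OF linear_H_pos]) (unfold H_pos_eq_current, subst current_commutator, simp_all)

lemma opC_tendsto: "ser_tendsto (\<lambda>M. opC scale b c M) (newton scale (H_pos b c))"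
  using reflected.reflected_opC_tendsto by (simp add: H_pos_eq_reflected_H_neg)

lemma newton_H_exchange:
  "newton scale (H_pos b c) i (newton scale (H_neg b c) j v) =
    (\<Sum>k\<le>i. if k \<le> j then newton scale (H_neg b c) (j - k) (newton scale (H_pos b c) (i - k) v) else 0)"
proof (rule newton_exchange[of "H_neg b c" "H_pos b c", OF linear_H_neg linear_H_pos])
  fix m n v
  show "H_pos b c (Suc m) (H_neg b c (Suc n) v) = H_neg b c (Suc n) (H_pos b c (Suc m) v)
      + (if n = m then scale (of_nat (Suc m)) v else 0)"
    unfolding H_neg_eq_current H_pos_eq_current
    by (subst current_commutator) auto
qed

end

theorem proposition2p4:
  fixes scale :: "'k::field_char_0 \<Rightarrow> 'v::ab_group_add \<Rightarrow> 'v"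
    and b c :: "int \<Rightarrow> 'v \<Rightarrow> 'v" and vac :: 'v
  assumes "fock_space scale b c vac"
  shows "ser_tendsto (\<lambda>M. opB scale b c M) (ser_exp scale (log_ser scale (H_neg b c)))
    \<and> ser_tendsto (\<lambda>M. opC scale b c M) (ser_exp scale (log_ser scale (H_pos b c)))
    \<and> (\<exists>L. ser_tendsto (\<lambda>M (i, j). opB scale b c M j \<circ> opC scale b c M i) L
         \<and> ser_tendsto (\<lambda>M (i, j). opC scale b c M i \<circ> opB scale b c M j)
             (ser2_scale scale geom_xy L))"
proof -
  interpret fock_space scale b c vac
    by (rule assms)
  let ?B = "newton scale (H_neg b c)" and ?C = "newton scale (H_pos b c)"
  let ?L = "\<lambda>(i, j). ?B j \<circ> ?C i"
  have "(?C i \<circ> ?B j) v = ser2_scale scale geom_xy ?L (i, j) v" for i j v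
  proof -
    have "(\<Sum>l\<le>j. scale (if k = l then 1 else 0) (?B (j - l) (?C (i - k) v)))
        = (if k \<le> j then ?B (j - k) (?C (i - k) v) else 0)" for k
    proof -
      have "(\<Sum>l\<le>j. scale (if k = l then 1 else 0) (?B (j - l) (?C (i - k) v)))
          = (\<Sum>l\<le>j. if l = k then ?B (j - k) (?C (i - k) v) else 0)"
        by (intro sum.cong) auto
      then show ?thesis by simp
    qed
    then show ?thesis
      by (simp add: ser2_scale_def geom_xy_def newton_H_exchange)
  qed
  then have "(\<lambda>(i, j). ?C i \<circ> ?B j) = ser2_scale scale geom_xy ?L"
    by (simp add: fun_eq_iff)
  moreover have "ser_tendsto (\<lambda>M (i, j). opB scale b c M j \<circ> opC scale b c M i) ?L"
    by (rule ser_tendsto_comp[OF opB_tendsto opC_tendsto])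
  moreover have "ser_tendsto (\<lambda>M (i, j). opC scale b c M i \<circ> opB scale b c M j) (\<lambda>(i, j). ?C i \<circ> ?B j)"
    by (rule ser_tendsto_comp[OF opC_tendsto opB_tendsto])
  ultimately show ?thesis
    using opB_tendsto opC_tendsto unfolding ser_exp_H_neg ser_exp_H_pos by auto
qed

end
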